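(* Let the numbers $n$, $p$, $n_\theta$ be fixed and let $m=p(N-n)$ vary with $N$. If the triangular factor $R$ is computed by the sparse Householder algorithm described in the context, then the computational complexity (number of floating-point operations) of a generic iteration of Algorithm (A), defined in the context, is $O(m^2)$; that is, there exist constants $M>0$ and $m_0>0$ such that for all $m>m_0$ the number of floating-point operations per iteration is at most $Mm^2$.
   Context: Setting. Let $n,p,q,n_\theta,N$ be positive integers with $N>n$, $\nu=n_\theta+pN$, $m=p(N-n)$. Let $\mathcal{M}:(\mathbb{R}^p)^n\times(\mathbb{R}^q)^{n+1}\times\mathbb{R}^{n_\theta}\to\mathbb{R}^p$ and $\rho:\mathbb{R}^{n_\theta}\to\mathbb{R}$ be differentiable, $u_t\in\mathbb{R}^q$, $\tilde y_t\in\mathbb{R}^p$ ($t=1,\dots,N$) given data, $W\in\mathbb{R}^{p\times p}$ positive definite, $\|\eta\|_W=\sqrt{\eta^\top W\eta}$. For $\xi=[\theta^\top,y_1^\top,\dots,y_N^\top]^\top\in\mathbb{R}^\nu$ let $f(\xi)=\sum_{t=1}^N\|\tilde y_t-y_t\|_W^2+\rho(\theta)$, and let $h:\mathbb{R}^\nu\to\mathbb{R}^m$ stack, in order of increasing $t$, the blocks $$h_t(\xi)=y_{t+n}-\mathcal{M}(y_{t+n-1},\dots,y_t,u_{t+n},\dots,u_t,\theta)\in\mathbb{R}^p,\qquad t=1,\dots,N-n.$$ $J_h(\xi)\in\mathbb{R}^{m\times\nu}$ is the Jacobian of $h$; it has full row rank for every $\xi$. In particular the rows of $J_h$ belonging to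 block $t$ can be nonzero only in the columns of $\theta$ and of $y_t,\dots,y_{t+n}$. Algorithm (A), iteration $k$ (with $K>0$, $\tau>0$): with $J=J_h(\xi_k)$, compute $$\sigma=(JJ^\top)^{-1}\big(-J\nabla f(\xi_k)+K h(\xi_k)\big),\qquad \xi_{k+1}=\xi_k+\tau\big(-\nabla f(\xi_k)-J^\top\sigma\big).$$ The vector $\sigma$ is computed by (1) obtaining the upper triangular factor $R\in\mathbb{R}^{m\times m}$ of a QR decomposition $J^\top=QR$ ($Q$ with orthonormal columns, not formed), so that $JJ^\top=R^\top R$; (2) solving the linear system with matrix $R^\top R$ by forward and backward substitution. Householder algorithm applied to $X=J^\top\in\mathbb{R}^{\nu\times m}$: start with $U=0_{\nu\times m}$, $R=0_{m\times m}$; for $k=1,\dots,m$ do: (i) $(U_{k:\nu,k},R_{k,k})=\mathrm{housegen}(X_{k:\nu,k})$; (ii) $v=U_{k:\nu,k}^\top X_{k:\nu,k+1:m}$; (iii) $X_{k:\nu,k+1:m}\leftarrow X_{k:\nu,k+1:m}-U_{k:\nu,k}v$; (iv) $R_{k,k+1:m}=X_{k,k+1:m}$. Here $\mathrm{housegen}(w)=(u,\mu)$ computes a vector $u$ such that $(I-uu^\top)w=\mu e_1$ with $\mu=\pm\|w\|_2$, as follows: set $u=w$, $\mu=\|w\|_2$; if $\mu=0$, set $u_1=\sqrt2$ and return; otherwise $u=w/\mu$; if $u_1\ge0$ set $u_1\leftarrow u_1+1$ and $\mu\leftarrow-\mu$, else $u_1\leftarrow u_1-1$; finally $u\leftarrow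 u/\sqrt{|u_1|}$. The sparse version of the algorithm performs the same steps but avoids (and does not count) all operations involving a multiplication by a zero entry; likewise the sparsity of $J$ is exploited in the products $J\nabla f(\xi_k)$ and $J^\top\sigma$. The operation count is that of the linear algebra of the iteration, given the values $J_h(\xi_k)$, $\nabla f(\xi_k)$, $h(\xi_k)$. *)

theory Defs
  imports
    "HOL-Analysis.Derivative"
    "HOL-Library.Monad_Syntax"
    "Jordan_Normal_Form.Matrix"
    "Jordan_Normal_Form.DL_Rank"
begin

unbundle no vec_syntax
hide_const (open) Finite_Cartesian_Product.vec Finite_Cartesian_Product.row
  Finite_Cartesian_Product.mat Finite_Cartesian_Product.transpose

section \<open>Computations with operation counts\<close>

text \<open>
  A value paired with the number of floating-point operations spent on it.  The arithmetic is
  exact.  Each addition, subtraction, negation, absolute value, multiplication, division and square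
  root is one operation; comparisons, assignments and index arithmetic are free.
\<close>

type_synonym 'a counted = "'a \<times> nat"

definition uncounted :: "'a \<Rightarrow> 'a counted" where
  "uncounted a = (a, 0)"

definition counted_bind :: "'a counted \<Rightarrow> ('a \<Rightarrow> 'b counted) \<Rightarrow> 'b counted" where
  "counted_bind c f = (fst (f (fst c)), snd c + snd (f (fst c)))"

adhoc_overloading Monad_Syntax.bind \<rightleftharpoons> counted_bind

definition fl_add :: "real \<Rightarrow> real \<Rightarrow> real counted" where "fl_add a b = (a + b, 1)"
definition fl_sub :: "real \<Rightarrow> real \<Rightarrow> real counted" where "fl_sub a b = (a - b, 1)"
definition fl_neg :: "real \<Rightarrow> real counted" where "fl_neg a = (- a, 1)"
definition fl_abs :: "real \<Rightarrow> real counted" where "fl_abs a = (\<bar>a\<bar>, 1)"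
definition fl_mul :: "real \<Rightarrow> real \<Rightarrow> real counted" where "fl_mul a b = (a * b, 1)"
definition fl_div :: "real \<Rightarrow> real \<Rightarrow> real counted" where "fl_div a b = (a / b, 1)"
definition fl_sqrt :: "real \<Rightarrow> real counted" where "fl_sqrt a = (sqrt a, 1)"

text \<open>
  The sparse operations skip every multiplication by a zero entry, together with the addition or
  subtraction of the product.  Dividing a zero entry counts as multiplying it by a reciprocal.
\<close>

definition sparse_div :: "real \<Rightarrow> real \<Rightarrow> real counted" where
  "sparse_div a b = (if a = 0 then uncounted 0 else fl_div a b)"

definition sparse_sub_mul :: "real \<Rightarrow> real \<Rightarrow> real \<Rightarrow> real counted" where
  "sparse_sub_mul x a b =
     (if a = 0 \<or> b = 0 then uncounted x else do { c \<leftarrow> fl_mul a b; fl_sub x c })"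

text \<open>Inner products are accumulated from 0, i.e. one multiplication and one addition per term.\<close>

definition sparse_dot :: "real vec \<Rightarrow> real vec \<Rightarrow> real counted" where
  "sparse_dot x y = (x \<bullet> y, 2 * card {i. i < dim_vec x \<and> x $ i \<noteq> 0 \<and> y $ i \<noteq> 0})"

definition dense_dot_on :: "nat set \<Rightarrow> (nat \<Rightarrow> real) \<Rightarrow> (nat \<Rightarrow> real) \<Rightarrow> real counted" where
  "dense_dot_on S x y = (\<Sum>i\<in>S. x i * y i, 2 * card S)"

definition vec_counted :: "nat \<Rightarrow> (nat \<Rightarrow> 'a counted) \<Rightarrow> 'a vec counted" where
  "vec_counted d f = (vec d (\<lambda>i. fst (f i)), \<Sum>i<d. snd (f i))"

definition mat_counted :: "nat \<Rightarrow> nat \<Rightarrow> (nat \<Rightarrow> nat \<Rightarrow> 'a counted) \<Rightarrow> 'a mat counted" where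
  "mat_counted r c f = (mat r c (\<lambda>(i, j). fst (f i j)), \<Sum>i<r. \<Sum>j<c. snd (f i j))"

fun foreach :: "'i list \<Rightarrow> ('i \<Rightarrow> 's \<Rightarrow> 's counted) \<Rightarrow> 's \<Rightarrow> 's counted" where
  "foreach [] f s = uncounted s"
| "foreach (i # is) f s = do { s' \<leftarrow> f i s; foreach is f s' }"


section \<open>Sparse Householder algorithm\<close>

text \<open>Vector and matrix indices start at 0 here.\<close>

definition housegen :: "real vec \<Rightarrow> (real vec \<times> real) counted" where
  "housegen w = do {
     s \<leftarrow> sparse_dot w w;
     \<mu> \<leftarrow> fl_sqrt s;
     if \<mu> = 0 then do { a \<leftarrow> fl_sqrt 2; uncounted (w |\<^sub>v 0 \<mapsto> a, \<mu>) }
     else do {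
       u \<leftarrow> vec_counted (dim_vec w) (\<lambda>i. sparse_div (w $ i) \<mu>);
       (u', \<mu>') \<leftarrow>
         (if u $ 0 \<ge> 0
          then do { a \<leftarrow> fl_add (u $ 0) 1; b \<leftarrow> fl_neg \<mu>; uncounted (u |\<^sub>v 0 \<mapsto> a, b) }
          else do { a \<leftarrow> fl_sub (u $ 0) 1; uncounted (u |\<^sub>v 0 \<mapsto> a, \<mu>) });
       c \<leftarrow> fl_abs (u' $ 0);
       d \<leftarrow> fl_sqrt c;
       u'' \<leftarrow> vec_counted (dim_vec w) (\<lambda>i. sparse_div (u' $ i) d);
       uncounted (u'', \<mu>')
     }
   }"

definition col_from :: "real mat \<Rightarrow> nat \<Rightarrow> nat \<Rightarrow> real vec" where
  "col_from A i j = vec (dim_row A - i) (\<lambda>r. A $$ (i + r, j))"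

definition householder_step ::
  "nat \<Rightarrow> nat \<Rightarrow> nat \<Rightarrow> real mat \<times> real mat \<times> real mat \<Rightarrow> (real mat \<times> real mat \<times> real mat) counted" where
  "householder_step \<nu> m k = (\<lambda>(U, R, X). do {
     (w, \<mu>) \<leftarrow> housegen (col_from X k k);
     let U' = mat \<nu> m (\<lambda>(i, j). if k \<le> i \<and> j = k then w $ (i - k) else U $$ (i, j));
     v \<leftarrow> vec_counted (m - Suc k)
           (\<lambda>j. sparse_dot (col_from U' k k) (col_from X k (Suc k + j)));
     X' \<leftarrow> mat_counted \<nu> m (\<lambda>i j.
            if k \<le> i \<and> k < j then sparse_sub_mul (X $$ (i, j)) (U' $$ (i, k)) (v $ (j - Suc k))
            else uncounted (X $$ (i, j)));
     let R' = mat m m (\<lambda>(i, j). if i = k \<and> j = k then \<mu>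
                               else if i = k \<and> k < j then X' $$ (k, j) else R $$ (i, j));
     uncounted (U', R', X')
   })"

definition sparse_householder :: "real mat \<Rightarrow> real mat counted" where
  "sparse_householder X = do {
     let \<nu> = dim_row X;
     let m = dim_col X;
     (U, R, X') \<leftarrow> foreach [0..<m] (householder_step \<nu> m) (0\<^sub>m \<nu> m, 0\<^sub>m m m, X);
     uncounted R
   }"


section \<open>Linear algebra of one iteration\<close>

text \<open>Forward substitution for \<open>R\<^sup>T z = b\<close> and backward substitution for \<open>R \<sigma> = z\<close>, where \<open>R\<close> is
  upper triangular and treated as dense.\<close>

definition forward_subst :: "real mat \<Rightarrow> real vec \<Rightarrow> real vec counted" where
  "forward_subst R b = foreach [0..<dim_vec b] (\<lambda>i z. do {
       s \<leftarrow> dense_dot_on {0..<i} (\<lambda>j. R $$ (j, i)) (\<lambda>j. z $ j);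
       r \<leftarrow> fl_sub (b $ i) s;
       x \<leftarrow> fl_div r (R $$ (i, i));
       uncounted (z |\<^sub>v i \<mapsto> x)
     }) (0\<^sub>v (dim_vec b))"

definition backward_subst :: "real mat \<Rightarrow> real vec \<Rightarrow> real vec counted" where
  "backward_subst R z = foreach (rev [0..<dim_vec z]) (\<lambda>i \<sigma>. do {
       s \<leftarrow> dense_dot_on {Suc i..<dim_vec z} (\<lambda>j. R $$ (i, j)) (\<lambda>j. \<sigma> $ j);
       r \<leftarrow> fl_sub (z $ i) s;
       x \<leftarrow> fl_div r (R $$ (i, i));
       uncounted (\<sigma> |\<^sub>v i \<mapsto> x)
     }) (0\<^sub>v (dim_vec z))"

text \<open>The values \<open>J\<close>, \<open>g\<close>, \<open>c\<close> of the Jacobian, the gradient and the constraint function at \<open>\<xi>\<close>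
  are given; only the linear algebra performed with them is counted.\<close>

definition iteration_step ::
  "real \<Rightarrow> real \<Rightarrow> real mat \<Rightarrow> real vec \<Rightarrow> real vec \<Rightarrow> real vec \<Rightarrow> real vec counted" where
  "iteration_step K \<tau> J g c \<xi> = do {
     R \<leftarrow> sparse_householder (transpose_mat J);
     b \<leftarrow> vec_counted (dim_row J) (\<lambda>i. do {
            a \<leftarrow> sparse_dot (row J i) g;
            a' \<leftarrow> fl_neg a;
            d \<leftarrow> fl_mul K (c $ i);
            fl_add a' d });
     z \<leftarrow> forward_subst R b;
     \<sigma> \<leftarrow> backward_subst R z;
     vec_counted (dim_col J) (\<lambda>j. do {
       a \<leftarrow> sparse_dot (col J j) \<sigma>;
       d \<leftarrow> fl_neg (g $ j);
       d' \<leftarrow> fl_sub d a;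
       e \<leftarrow> fl_mul \<tau> d';
       fl_add (\<xi> $ j) e })
   }"


section \<open>The estimation problem\<close>

definition eucl_norm :: "real vec \<Rightarrow> real" where
  "eucl_norm x = sqrt (x \<bullet> x)"

text \<open>Frechet differentiability, at every point, of a map from \<open>\<real>\<^sup>a\<close> to \<open>\<real>\<^sup>b\<close>.\<close>

definition differentiable_map :: "nat \<Rightarrow> nat \<Rightarrow> (real vec \<Rightarrow> real vec) \<Rightarrow> bool" where
  "differentiable_map a b F \<longleftrightarrow>
     (\<forall>x\<in>carrier_vec a. F x \<in> carrier_vec b) \<and>
     (\<forall>x\<in>carrier_vec a. \<exists>D\<in>carrier_mat b a. \<forall>\<epsilon>>0. \<exists>\<delta>>0. \<forall>z\<in>carrier_vec a.
        eucl_norm (z - x) < \<delta> \<longrightarrow>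
        eucl_norm (F z - F x - D *\<^sub>v (z - x)) \<le> \<epsilon> * eucl_norm (z - x))"

definition partial_deriv :: "(real vec \<Rightarrow> real) \<Rightarrow> nat \<Rightarrow> real vec \<Rightarrow> real" where
  "partial_deriv F j x = deriv (\<lambda>s. F (x + s \<cdot>\<^sub>v unit_vec (dim_vec x) j)) 0"

definition gradient :: "(real vec \<Rightarrow> real) \<Rightarrow> real vec \<Rightarrow> real vec" where
  "gradient F x = vec (dim_vec x) (\<lambda>j. partial_deriv F j x)"

definition jacobian :: "nat \<Rightarrow> (real vec \<Rightarrow> real vec) \<Rightarrow> real vec \<Rightarrow> real mat" where
  "jacobian m F x = mat m (dim_vec x) (\<lambda>(i, j). partial_deriv (\<lambda>z. F z $ i) j x)"

definition positive_definite :: "nat \<Rightarrow> real mat \<Rightarrow> bool" where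
  "positive_definite d W \<longleftrightarrow>
     W \<in> carrier_mat d d \<and> (\<forall>x\<in>carrier_vec d. x \<noteq> 0\<^sub>v d \<longrightarrow> x \<bullet> (W *\<^sub>v x) > 0)"

definition weighted_norm :: "real mat \<Rightarrow> real vec \<Rightarrow> real" where
  "weighted_norm W x = sqrt (x \<bullet> (W *\<^sub>v x))"

definition stack :: "real vec list \<Rightarrow> real vec" where
  "stack xs = vec_of_list (concat (map list_of_vec xs))"

text \<open>Components of \<open>\<xi> = stack [\<theta>, y\<^sub>1, \<dots>, y\<^sub>N]\<close>; the time index \<open>t\<close> starts at 1.\<close>

definition theta_part :: "nat \<Rightarrow> real vec \<Rightarrow> real vec" where
  "theta_part n_theta \<xi> = vec n_theta (\<lambda>i. \<xi> $ i)"

definition y_part :: "nat \<Rightarrow> nat \<Rightarrow> real vec \<Rightarrow> nat \<Rightarrow> real vec" where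
  "y_part p n_theta \<xi> t = vec p (\<lambda>i. \<xi> $ (n_theta + p * (t - 1) + i))"

definition objective ::
  "nat \<Rightarrow> nat \<Rightarrow> nat \<Rightarrow> (nat \<Rightarrow> real vec) \<Rightarrow> real mat \<Rightarrow> (real vec \<Rightarrow> real) \<Rightarrow> real vec \<Rightarrow> real" where
  "objective p n_theta N ydata W \<rho> \<xi> =
     (\<Sum>t=1..N. (weighted_norm W (ydata t - y_part p n_theta \<xi> t))\<^sup>2) + \<rho> (theta_part n_theta \<xi>)"

text \<open>The model is a map on \<open>\<real>\<^bsup>np + (n+1)q + n_theta\<^esup>\<close>, identified with
  \<open>(\<real>\<^sup>p)\<^sup>n \<times> (\<real>\<^sup>q)\<^bsup>n+1\<^esup> \<times> \<real>\<^bsup>n_theta\<^esup>\<close> by stacking the arguments in order.\<close>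

definition constraint_block ::
  "nat \<Rightarrow> nat \<Rightarrow> nat \<Rightarrow> (real vec \<Rightarrow> real vec) \<Rightarrow> (nat \<Rightarrow> real vec) \<Rightarrow> real vec \<Rightarrow> nat \<Rightarrow> real vec" where
  "constraint_block n p n_theta model u \<xi> t =
     y_part p n_theta \<xi> (t + n) -
     model (stack (map (y_part p n_theta \<xi>) (rev [t..<t + n]) @ map u (rev [t..<t + n + 1])
                   @ [theta_part n_theta \<xi>]))"

definition constraint ::
  "nat \<Rightarrow> nat \<Rightarrow> nat \<Rightarrow> nat \<Rightarrow> (real vec \<Rightarrow> real vec) \<Rightarrow> (nat \<Rightarrow> real vec) \<Rightarrow> real vec \<Rightarrow> real vec" where
  "constraint n p n_theta N model u \<xi> =
     vec (p * (N - n)) (\<lambda>i. constraint_block n p n_theta model u \<xi> (i div p + 1) $ (i mod p))"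

abbreviation constraint_jacobian ::
  "nat \<Rightarrow> nat \<Rightarrow> nat \<Rightarrow> nat \<Rightarrow> (real vec \<Rightarrow> real vec) \<Rightarrow> (nat \<Rightarrow> real vec) \<Rightarrow> real vec \<Rightarrow> real mat" where
  "constraint_jacobian n p n_theta N model u \<equiv>
     jacobian (p * (N - n)) (constraint n p n_theta N model u)"

text \<open>In the last clause, \<^const>\<open>vec_space.rank\<close> is the dimension of the column space, so
  rank equal to the number of rows is full row rank.\<close>

definition estimation_problem ::
  "nat \<Rightarrow> nat \<Rightarrow> nat \<Rightarrow> nat \<Rightarrow> nat \<Rightarrow> (real vec \<Rightarrow> real vec) \<Rightarrow> (real vec \<Rightarrow> real) \<Rightarrow>
   (nat \<Rightarrow> real vec) \<Rightarrow> (nat \<Rightarrow> real vec) \<Rightarrow> real mat \<Rightarrow> bool" where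
  "estimation_problem n p q n_theta N model \<rho> u ydata W \<longleftrightarrow>
     0 < n \<and> 0 < p \<and> 0 < q \<and> 0 < n_theta \<and> n < N \<and>
     differentiable_map (n * p + (n + 1) * q + n_theta) p model \<and>
     differentiable_map n_theta 1 (\<lambda>\<theta>. vec 1 (\<lambda>_. \<rho> \<theta>)) \<and>
     (\<forall>t\<in>{1..N}. u t \<in> carrier_vec q \<and> ydata t \<in> carrier_vec p) \<and>
     positive_definite p W \<and>
     (\<forall>\<xi>\<in>carrier_vec (n_theta + p * N).
        vec_space.rank (p * (N - n)) (constraint_jacobian n p n_theta N model u \<xi>) = p * (N - n))"

definition algorithm_step ::
  "nat \<Rightarrow> nat \<Rightarrow> nat \<Rightarrow> nat \<Rightarrow> (real vec \<Rightarrow> real vec) \<Rightarrow> (real vec \<Rightarrow> real) \<Rightarrow>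
   (nat \<Rightarrow> real vec) \<Rightarrow> (nat \<Rightarrow> real vec) \<Rightarrow> real mat \<Rightarrow> real \<Rightarrow> real \<Rightarrow> real vec \<Rightarrow> real vec counted" where
  "algorithm_step n p n_theta N model \<rho> u ydata W K \<tau> \<xi> =
     iteration_step K \<tau>
       (constraint_jacobian n p n_theta N model u \<xi>)
       (gradient (objective p n_theta N ydata W \<rho>) \<xi>)
       (constraint n p n_theta N model u \<xi>) \<xi>"

definition iterate ::
  "nat \<Rightarrow> nat \<Rightarrow> nat \<Rightarrow> nat \<Rightarrow> (real vec \<Rightarrow> real vec) \<Rightarrow> (real vec \<Rightarrow> real) \<Rightarrow>
   (nat \<Rightarrow> real vec) \<Rightarrow> (nat \<Rightarrow> real vec) \<Rightarrow> real mat \<Rightarrow> real \<Rightarrow> real \<Rightarrow> real vec \<Rightarrow> nat \<Rightarrow> real vec" where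
  "iterate n p n_theta N model \<rho> u ydata W K \<tau> \<xi>\<^sub>0 k =
     ((\<lambda>\<xi>. fst (algorithm_step n p n_theta N model \<rho> u ydata W K \<tau> \<xi>)) ^^ k) \<xi>\<^sub>0"

definition iteration_flops ::
  "nat \<Rightarrow> nat \<Rightarrow> nat \<Rightarrow> nat \<Rightarrow> (real vec \<Rightarrow> real vec) \<Rightarrow> (real vec \<Rightarrow> real) \<Rightarrow>
   (nat \<Rightarrow> real vec) \<Rightarrow> (nat \<Rightarrow> real vec) \<Rightarrow> real mat \<Rightarrow> real \<Rightarrow> real \<Rightarrow> real vec \<Rightarrow> nat \<Rightarrow> nat" where
  "iteration_flops n p n_theta N model \<rho> u ydata W K \<tau> \<xi>\<^sub>0 k =
     snd (algorithm_step n p n_theta N model \<rho> u ydata W K \<tau>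
            (iterate n p n_theta N model \<rho> u ydata W K \<tau> \<xi>\<^sub>0 k))"

end

(*
  The constraint function h_i does not involve the coordinates of xi with index at least i + c,
  where c = n_theta + p (n + 1) does not depend on N.  So X = J^T has lower bandwidth c, and this
  property survives every Householder step: the reflector of step k has support in [k, k + c), and
  the columns j > k it is subtracted from may be nonzero up to row j + c.  Each step therefore
  costs O(c m) operations.  All remaining parts are dense products and substitutions of cost
  O(m nu) with nu <= (c + 1) m.
*)
theory Submission
  imports Defs
begin

section \<open>Operation counts\<close>

lemma fst_uncounted [simp]: "fst (uncounted a) = a"
  and snd_uncounted [simp]: "snd (uncounted a) = 0"
  by (simp_all add: uncounted_def)

lemma fst_counted_bind [simp]: "fst (counted_bind x f) = fst (f (fst x))"
  and snd_counted_bind [simp]: "snd (counted_bind x f) = snd x + snd (f (fst x))"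
  by (simp_all add: counted_bind_def)

lemma snd_fl_ops [simp]:
  "snd (fl_add a b) = 1" "snd (fl_sub a b) = 1" "snd (fl_neg a) = 1" "snd (fl_abs a) = 1"
  "snd (fl_mul a b) = 1" "snd (fl_div a b) = 1" "snd (fl_sqrt a) = 1"
  by (simp_all add: fl_add_def fl_sub_def fl_neg_def fl_abs_def fl_mul_def fl_div_def fl_sqrt_def)

lemma fst_vec_counted [simp]: "fst (vec_counted d f) = vec d (\<lambda>i. fst (f i))"
  and fst_mat_counted [simp]: "fst (mat_counted r s g) = mat r s (\<lambda>(i, j). fst (g i j))"
  by (simp_all add: vec_counted_def mat_counted_def)

lemma fst_sparse_div_0 [simp]: "fst (sparse_div 0 b) = 0"
  by (simp add: sparse_div_def)

lemma snd_sparse_div: "snd (sparse_div a b) = (if a = 0 then 0 else 1)"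
  by (simp add: sparse_div_def)

lemma fst_sparse_sub_mul [simp]: "fst (sparse_sub_mul x a b) = x - a * b"
  by (simp add: sparse_sub_mul_def fl_mul_def fl_sub_def)

lemma snd_sparse_sub_mul: "snd (sparse_sub_mul x a b) \<le> (if a = 0 then 0 else 2)"
  by (simp add: sparse_sub_mul_def)

lemma snd_sparse_dot_le:
  assumes "\<And>i. i < dim_vec x \<Longrightarrow> c \<le> i \<Longrightarrow> x $ i = 0"
  shows "snd (sparse_dot x y) \<le> 2 * c"
proof -
  have "{i. i < dim_vec x \<and> x $ i \<noteq> 0 \<and> y $ i \<noteq> 0} \<subseteq> {..<c}"
    using assms not_le by blast
  from card_mono[OF _ this] show ?thesis
    by (simp add: sparse_dot_def)
qed

lemma snd_sparse_dot_le_dim: "snd (sparse_dot x y) \<le> 2 * dim_vec x"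
  by (rule snd_sparse_dot_le) simp

lemma snd_vec_counted_le:
  assumes "\<And>i. i < d \<Longrightarrow> snd (f i) \<le> B"
  shows "snd (vec_counted d f) \<le> d * B"
  using sum_bounded_above[of "{..<d}" "\<lambda>i. snd (f i)" B] assms
  by (simp add: vec_counted_def)

text \<open>The bound does not depend on \<open>d\<close>, so a sum over all rows of a matrix costs
  only as much as its few active rows.\<close>

lemma sum_le_card_support:
  fixes f :: "nat \<Rightarrow> nat"
  assumes "\<And>i. i < d \<Longrightarrow> f i \<le> B" "\<And>i. i < d \<Longrightarrow> i \<notin> S \<Longrightarrow> f i = 0" "finite S"
  shows "(\<Sum>i<d. f i) \<le> card S * B"
proof -
  have "(\<Sum>i<d. f i) = (\<Sum>i\<in>{..<d} \<inter> S. f i)"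
    using assms(2) by (intro sum.mono_neutral_right) auto
  also have "\<dots> \<le> card ({..<d} \<inter> S) * B"
    using sum_bounded_above[of "{..<d} \<inter> S" f B] assms(1) by simp
  also have "\<dots> \<le> card S * B"
    by (intro mult_right_mono card_mono) (use assms(3) in auto)
  finally show ?thesis .
qed

lemma snd_vec_counted_sparse_div_le:
  assumes "\<And>i. i < d \<Longrightarrow> c \<le> i \<Longrightarrow> x $ i = 0"
  shows "snd (vec_counted d (\<lambda>i. sparse_div (x $ i) b)) \<le> c"
  using sum_le_card_support[of d "\<lambda>i. snd (sparse_div (x $ i) b)" 1 "{..<c}"] assms
  by (simp add: vec_counted_def snd_sparse_div)

text \<open>State and cost are treated together because the cost bound \<open>B\<close> of a loop
  body is available only for states satisfying \<open>P\<close>.\<close>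

lemma foreach_invariant:
  assumes "\<And>i s. i \<in> set xs \<Longrightarrow> P s \<Longrightarrow> P (fst (f i s)) \<and> snd (f i s) \<le> B" and "P s"
  shows "P (fst (foreach xs f s)) \<and> snd (foreach xs f s) \<le> length xs * B"
  using assms
proof (induction xs arbitrary: s)
  case (Cons i xs)
  have "P (fst (f i s))" "snd (f i s) \<le> B"
    using Cons.prems by auto
  with Cons.IH[of "fst (f i s)"] Cons.prems(1) show ?case
    by fastforce
qed simp


section \<open>The sparse Householder algorithm on banded matrices\<close>

text \<open>Both divisions act entrywise and keep zeros. The only entry overwritten is the one at
  index 0, which \<open>0 < c\<close> places among the first \<open>c\<close> entries.\<close>

lemma housegen_support:
  assumes w: "\<And>i. i < dim_vec w \<Longrightarrow> c \<le> i \<Longrightarrow> w $ i = 0" and "0 < c"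
  shows "i < dim_vec w \<Longrightarrow> c \<le> i \<Longrightarrow> fst (fst (housegen w)) $ i = 0"
    and "snd (housegen w) \<le> 4 * c + 6"
proof -
  define d where "d = dim_vec w"
  define \<mu> where "\<mu> = fst (fl_sqrt (fst (sparse_dot w w)))"
  define u where "u = vec d (\<lambda>i. fst (sparse_div (w $ i) \<mu>))"
  define a where "a = (if u $ 0 \<ge> 0 then fst (fl_add (u $ 0) 1) else fst (fl_sub (u $ 0) 1))"
  define u' where "u' = u |\<^sub>v 0 \<mapsto> a"
  define e where "e = fst (fl_sqrt (fst (fl_abs (u' $ 0))))"
  have u': "u' $ i = 0" if "i < d" "c \<le> i" for i
    using that w \<open>0 < c\<close> by (simp add: u'_def u_def d_def)
  have eq: "fst (fst (housegen w)) = (if \<mu> = 0 then w |\<^sub>v 0 \<mapsto> fst (fl_sqrt 2)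
      else vec d (\<lambda>i. fst (sparse_div (u' $ i) e)))"
    by (simp add: housegen_def Let_def e_def u'_def a_def u_def \<mu>_def d_def split_beta)
  show "fst (fst (housegen w)) $ i = 0" if "i < dim_vec w" "c \<le> i"
    using that w u' \<open>0 < c\<close> by (simp add: eq d_def)
  \<comment> \<open>At most five scalar operations accompany the inner product and the two
    divisions, so 6 leaves some slack.\<close>
  have "snd (housegen w) \<le> snd (sparse_dot w w) + snd (vec_counted d (\<lambda>i. sparse_div (w $ i) \<mu>))
      + snd (vec_counted d (\<lambda>i. sparse_div (u' $ i) e)) + 6"
    by (simp add: housegen_def Let_def e_def u'_def a_def u_def \<mu>_def d_def split_beta)
  moreover have "snd (sparse_dot w w) \<le> 2 * c"
    by (rule snd_sparse_dot_le) (rule w)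
  moreover have "snd (vec_counted d (\<lambda>i. sparse_div (w $ i) \<mu>)) \<le> c"
    by (rule snd_vec_counted_sparse_div_le) (simp add: w d_def)
  moreover have "snd (vec_counted d (\<lambda>i. sparse_div (u' $ i) e)) \<le> c"
    by (rule snd_vec_counted_sparse_div_le) (rule u')
  ultimately show "snd (housegen w) \<le> 4 * c + 6"
    by linarith
qed

text \<open>The condition is one-sided: entries above the diagonal are free. This admits the top
  rows of the transposed Jacobian, which belong to \<open>\<theta>\<close> and may be nonzero in
  every column.\<close>

definition lower_band :: "nat \<Rightarrow> real mat \<Rightarrow> bool" where
  "lower_band c X \<longleftrightarrow> (\<forall>i<dim_row X. \<forall>j<dim_col X. j + c \<le> i \<longrightarrow> X $$ (i, j) = 0)"

text \<open>No fill-in leaves the band: for \<open>k < j\<close>, a row \<open>i\<close> with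
  \<open>j + c \<le> i\<close> lies beyond the support of the reflector. The inner products and the
  update of \<open>X\<close> cost at most \<open>2 * c * m\<close> each.\<close>

lemma householder_step_band:
  assumes X: "X \<in> carrier_mat \<nu> m" "lower_band c X" and "k < m" and "0 < c"
  shows "snd (snd (fst (householder_step \<nu> m k (U, R, X)))) \<in> carrier_mat \<nu> m
      \<and> lower_band c (snd (snd (fst (householder_step \<nu> m k (U, R, X)))))"
    and "snd (householder_step \<nu> m k (U, R, X)) \<le> 4 * c + 6 + 4 * c * m"
proof -
  define w where "w = col_from X k k"
  define U' where "U' = mat \<nu> m (\<lambda>(i, j). if k \<le> i \<and> j = k then fst (fst (housegen w)) $ (i - k)
                                          else U $$ (i, j))"
  define dots where "dots = vec_counted (m - Suc k)
           (\<lambda>j. sparse_dot (col_from U' k k) (col_from X k (Suc k + j)))"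
  define upd where "upd = (\<lambda>i j. if k \<le> i \<and> k < j
            then sparse_sub_mul (X $$ (i, j)) (U' $$ (i, k)) (fst dots $ (j - Suc k))
            else uncounted (X $$ (i, j)))"
  have dim_w: "dim_vec w = \<nu> - k"
    using X(1) by (simp add: w_def col_from_def)
  have w: "w $ i = 0" if "i < dim_vec w" "c \<le> i" for i
    using that X \<open>k < m\<close> by (simp add: w_def col_from_def lower_band_def)
  note hg = housegen_support[of w c, OF w \<open>0 < c\<close>]
  have U': "U' $$ (i, k) = 0" if "i < \<nu>" "k + c \<le> i" for i
    using that \<open>k < m\<close> hg(1)[of "i - k"] by (simp add: U'_def dim_w)
  have X': "snd (snd (fst (householder_step \<nu> m k (U, R, X)))) = mat \<nu> m (\<lambda>(i, j). fst (upd i j))"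
    by (simp add: householder_step_def Let_def upd_def dots_def U'_def w_def split_beta
        cong: if_cong)
  have "fst (upd i j) = 0" if "i < \<nu>" "j < m" "j + c \<le> i" for i j
    using that X U'[of i] by (auto simp: upd_def lower_band_def)
  then show "snd (snd (fst (householder_step \<nu> m k (U, R, X)))) \<in> carrier_mat \<nu> m
      \<and> lower_band c (snd (snd (fst (householder_step \<nu> m k (U, R, X)))))"
    by (simp add: X' lower_band_def)
  have "snd dots \<le> (m - Suc k) * (2 * c)"
    unfolding dots_def
    by (intro snd_vec_counted_le snd_sparse_dot_le)
      (use U' in \<open>simp add: col_from_def U'_def[THEN arg_cong[where f = dim_row]]\<close>)
  also have "\<dots> \<le> 2 * c * m"
    by simp
  finally have dots: "snd dots \<le> 2 * c * m" .
  \<comment> \<open>Only zeros of the reflector are exploited here, not those of \<open>v\<close>.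
    This confines the cost to \<open>c\<close> rows with at most \<open>m\<close> updates
    each.\<close>
  have upd: "snd (upd i j) \<le> 2" "U' $$ (i, k) = 0 \<or> i < k \<Longrightarrow> snd (upd i j) = 0" for i j
    using snd_sparse_sub_mul[of "X $$ (i, j)" "U' $$ (i, k)" "fst dots $ (j - Suc k)"]
    by (auto simp: upd_def split: if_splits)
  have "(\<Sum>i<\<nu>. \<Sum>j<m. snd (upd i j)) \<le> card {k..<k + c} * (m * 2)"
  proof (rule sum_le_card_support)
    show "(\<Sum>j<m. snd (upd i j)) \<le> m * 2" for i
      using sum_bounded_above[of "{..<m}" "\<lambda>j. snd (upd i j)" 2] upd(1) by simp
    show "(\<Sum>j<m. snd (upd i j)) = 0" if "i < \<nu>" "i \<notin> {k..<k + c}" for i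
      using that upd(2)[of i] U'[of i] by (intro sum.neutral) auto
  qed simp
  then have "(\<Sum>i<\<nu>. \<Sum>j<m. snd (upd i j)) \<le> 2 * c * m"
    by (simp add: mult_ac)
  moreover have "snd (householder_step \<nu> m k (U, R, X))
      = snd (housegen w) + snd dots + (\<Sum>i<\<nu>. \<Sum>j<m. snd (upd i j))"
    by (simp add: householder_step_def Let_def mat_counted_def upd_def dots_def U'_def w_def
        split_beta cong: if_cong)
  ultimately show "snd (householder_step \<nu> m k (U, R, X)) \<le> 4 * c + 6 + 4 * c * m"
    using hg(2) dots by linarith
qed

lemma sparse_householder_flops:
  assumes "lower_band c X" and "0 < c" and m: "m = dim_col X"
  shows "snd (sparse_householder X) \<le> m * (4 * c + 6 + 4 * c * m)"
proof -
  \<comment> \<open>The invariant speaks of \<open>X'\<close> alone, since the bound for one step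
    holds for arbitrary \<open>U\<close> and \<open>R\<close>.\<close>
  define P where "P = (\<lambda>(_ :: real mat, _ :: real mat, X').
    X' \<in> carrier_mat (dim_row X) m \<and> lower_band c X')"
  have step: "P (fst (householder_step (dim_row X) m k s))
      \<and> snd (householder_step (dim_row X) m k s) \<le> 4 * c + 6 + 4 * c * m"
    if k: "k \<in> set [0..<m]" and "P s" for k s
  proof (cases s)
    case (fields U R X')
    then have "X' \<in> carrier_mat (dim_row X) m" "lower_band c X'"
      using \<open>P s\<close> by (simp_all add: P_def)
    from householder_step_band[OF this _ \<open>0 < c\<close>, of k U R] k show ?thesis
      by (simp add: fields P_def split_beta)
  qed
  have "P (0\<^sub>m (dim_row X) m, 0\<^sub>m m m, X)"
    using assms by (auto simp: P_def)
  from foreach_invariant[of "[0..<m]" P, OF step this] show ?thesis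
    by (simp add: sparse_householder_def Let_def m split_beta)
qed


section \<open>Cost of one iteration\<close>

text \<open>Each inner product is bounded crudely by full length; the extra 2 is the subtraction and
  the division. The dimension is tracked because the result is the input of
  \<open>backward_subst\<close>.\<close>

lemma forward_subst_flops:
  "dim_vec (fst (forward_subst R b)) = dim_vec b
   \<and> snd (forward_subst R b) \<le> dim_vec b * (2 * dim_vec b + 2)"
  unfolding forward_subst_def
  by (rule foreach_invariant[of "[0..<dim_vec b]" "\<lambda>z. dim_vec z = dim_vec b",
        unfolded length_upt diff_zero]) (simp_all add: dense_dot_on_def)

lemma backward_subst_flops:
  "snd (backward_subst R z) \<le> dim_vec z * (2 * dim_vec z + 2)"
  unfolding backward_subst_def
  by (rule foreach_invariant[of "rev [0..<dim_vec z]" "\<lambda>_. True",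
        unfolded length_rev length_upt diff_zero, THEN conjunct2]) (simp_all add: dense_dot_on_def)

text \<open>Sparsity matters only for the factorization. The other products are bounded as dense
  ones, which stays quadratic because \<open>\<nu> \<le> c + m\<close>.\<close>

lemma iteration_step_flops:
  assumes J: "J \<in> carrier_mat m \<nu>" and g: "dim_vec g = \<nu>"
    and band: "lower_band c (transpose_mat J)" and "0 < c" and "0 < m" and \<nu>: "\<nu> \<le> c + m"
  shows "snd (iteration_step K \<tau> J g h \<xi>) \<le> (16 * c + 25) * m\<^sup>2"
proof -
  define R where "R = fst (sparse_householder (transpose_mat J))"
  define bc where "bc = vec_counted (dim_row J) (\<lambda>i. do {
            a \<leftarrow> sparse_dot (row J i) g;
            a' \<leftarrow> fl_neg a;
            d \<leftarrow> fl_mul K (h $ i);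
            fl_add a' d })"
  define z where "z = fst (forward_subst R (fst bc))"
  define \<sigma> where "\<sigma> = fst (backward_subst R z)"
  define \<xi>c where "\<xi>c = vec_counted (dim_col J) (\<lambda>j. do {
       a \<leftarrow> sparse_dot (col J j) \<sigma>;
       d \<leftarrow> fl_neg (g $ j);
       d' \<leftarrow> fl_sub d a;
       e \<leftarrow> fl_mul \<tau> d';
       fl_add (\<xi> $ j) e })"
  have dim_b: "dim_vec (fst bc) = m"
    using J by (simp add: bc_def)
  then have dim_z: "dim_vec z = m"
    by (simp add: z_def forward_subst_flops)
  have split: "snd (iteration_step K \<tau> J g h \<xi>) = snd (sparse_householder (transpose_mat J))
      + snd bc + snd (forward_subst R (fst bc)) + snd (backward_subst R z) + snd \<xi>c"
    by (simp add: iteration_step_def R_def bc_def z_def \<sigma>_def \<xi>c_def)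
  have mm: "m \<le> m * m" "c \<le> c * m" "c * m \<le> c * (m * m)"
    using \<open>0 < m\<close> by (simp_all add: Suc_leI)
  have \<nu>m: "m * \<nu> \<le> c * (m * m) + m * m"
  proof -
    have "m * \<nu> \<le> m * (c + m)"
      using \<nu> by simp
    also have "\<dots> \<le> c * (m * m) + m * m"
      using mm(3) by (simp add: algebra_simps)
    finally show ?thesis .
  qed
  have "snd (sparse_householder (transpose_mat J)) \<le> m * (4 * c + 6 + 4 * c * m)"
    using sparse_householder_flops[OF band \<open>0 < c\<close>, of m] J by simp
  also have "\<dots> = 4 * (c * m) + 6 * m + 4 * (c * (m * m))"
    by (simp add: algebra_simps)
  finally have 1: "snd (sparse_householder (transpose_mat J)) \<le> \<dots>" .
  have "snd bc \<le> m * (2 * \<nu> + 3)"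
    unfolding bc_def carrier_matD(1)[OF J]
    by (rule snd_vec_counted_le) (use snd_sparse_dot_le_dim[of "row J _" g] J in simp)
  also have "\<dots> = 2 * (m * \<nu>) + 3 * m"
    by (simp add: algebra_simps)
  finally have 2: "snd bc \<le> \<dots>" .
  have 3: "snd (forward_subst R (fst bc)) \<le> 2 * (m * m) + 2 * m"
    using forward_subst_flops[of R "fst bc"] by (simp add: dim_b algebra_simps)
  have 4: "snd (backward_subst R z) \<le> 2 * (m * m) + 2 * m"
    using backward_subst_flops[of R z] by (simp add: dim_z algebra_simps)
  have "snd \<xi>c \<le> \<nu> * (2 * m + 4)"
    unfolding \<xi>c_def carrier_matD(2)[OF J]
    by (rule snd_vec_counted_le) (use snd_sparse_dot_le_dim[of "col J _" \<sigma>] J in simp)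
  also have "\<dots> = 2 * (m * \<nu>) + 4 * \<nu>"
    by (simp add: algebra_simps)
  finally have 5: "snd \<xi>c \<le> \<dots>" .
  \<comment> \<open>Coefficient of \<open>c * (m * m)\<close>: 8 from the factorization, 4 from
    \<open>4 * (m * \<nu>)\<close>, 4 from \<open>4 * \<nu>\<close>. Coefficient of
    \<open>m * m\<close>: 13 from linear terms, 4 from the substitutions, and again 4 and 4.\<close>
  have "snd (iteration_step K \<tau> J g h \<xi>) \<le> 16 * (c * (m * m)) + 25 * (m * m)"
    using split 1 2 3 4 5 mm \<nu>m \<nu> by linarith
  then show ?thesis
    by (simp add: algebra_simps power2_eq_square)
qed

lemma dim_algorithm_step:
  "dim_vec (fst (algorithm_step n p n_theta N model \<rho> u ydata W K \<tau> \<xi>)) = dim_vec \<xi>"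
  by (simp add: algorithm_step_def iteration_step_def jacobian_def)

text \<open>Every iterate stays in the space of the initial point, so a cost bound at an arbitrary
  point covers all iterations.\<close>

lemma dim_iterate:
  "dim_vec (iterate n p n_theta N model \<rho> u ydata W K \<tau> \<xi> k) = dim_vec \<xi>"
  by (induction k) (simp_all add: iterate_def dim_algorithm_step)


section \<open>The band structure of the Jacobian\<close>

lemma partial_deriv_eq_0:
  assumes "\<And>s. F (x + s \<cdot>\<^sub>v unit_vec (dim_vec x) j) = F x"
  shows "partial_deriv F j x = 0"
  by (simp add: partial_deriv_def assms)

text \<open>Component \<open>i\<close> belongs to block \<open>t = i div p + 1\<close>, which reads
  only coordinates below \<open>n_theta + p * (t + n)\<close>. This is at most
  \<open>i + (n_theta + p * (n + 1))\<close>, hence at most \<open>j\<close>.\<close>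

lemma constraint_perturb:
  assumes "0 < p" and i: "i < p * (N - n)" and x: "dim_vec x = n_theta + p * N"
    and j: "i + (n_theta + p * (n + 1)) \<le> j"
  shows "constraint n p n_theta N model u (x + s \<cdot>\<^sub>v unit_vec (dim_vec x) j) $ i
       = constraint n p n_theta N model u x $ i"
proof -
  let ?x' = "x + s \<cdot>\<^sub>v unit_vec (dim_vec x) j"
  define t where "t = i div p + 1"
  have t: "t \<le> N - n"
    using i \<open>0 < p\<close> by (simp add: t_def less_mult_imp_div_less mult.commute Suc_leI)
  \<comment> \<open>The shift by one in \<open>t\<close> contributes the extra \<open>p\<close>,
    whence \<open>n + 1\<close> rather than \<open>n\<close> in the bandwidth.\<close>
  have pt: "p * t \<le> i + p"
    by (simp add: t_def)
  have coord: "?x' $ l = x $ l" if "l < n_theta + p * (t + n)" for l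
  proof -
    \<comment> \<open>Subtraction truncates, but \<open>N < n\<close> would make
      \<open>p * (N - n)\<close> zero, contradicting \<open>i < p * (N - n)\<close>.\<close>
    have "t + n \<le> N"
      using t i \<open>0 < p\<close> by (cases "n \<le> N") auto
    then have "p * (t + n) \<le> p * N"
      by (rule mult_le_mono2)
    with that have "l < dim_vec x"
      unfolding x by linarith
    moreover have "l < j"
      using that j pt by (simp add: algebra_simps)
    ultimately show ?thesis
      by (simp add: unit_vec_def)
  qed
  have y: "y_part p n_theta ?x' r = y_part p n_theta x r" if "1 \<le> r" "r \<le> t + n" for r
  proof (rule eq_vecI)
    fix l assume "l < dim_vec (y_part p n_theta x r)"
    then have "l < p"
      by (simp add: y_part_def)
    \<comment> \<open>Here \<open>1 \<le> r\<close> matters, since \<open>r - 1\<close> truncates at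
      0.\<close>
    then have "p * (r - 1) + l < p * r"
      using that(1) by (cases r) simp_all
    also have "\<dots> \<le> p * (t + n)"
      using that(2) by simp
    finally have "?x' $ (n_theta + p * (r - 1) + l) = x $ (n_theta + p * (r - 1) + l)"
      by (intro coord) simp
    then show "y_part p n_theta ?x' r $ l = y_part p n_theta x r $ l"
      using \<open>l < p\<close> unfolding y_part_def by simp
  qed (simp add: y_part_def)
  then have ys: "map (y_part p n_theta ?x') (rev [t..<t + n])
      = map (y_part p n_theta x) (rev [t..<t + n])"
    by (intro map_cong) (auto simp: t_def)
  have "theta_part n_theta ?x' = theta_part n_theta x"
    unfolding theta_part_def by (intro eq_vecI) (simp_all only: index_vec dim_vec coord trans_less_add1)
  moreover have "y_part p n_theta ?x' (t + n) = y_part p n_theta x (t + n)"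
    by (rule y) (simp_all add: t_def)
  ultimately have "constraint_block n p n_theta model u ?x' t
      = constraint_block n p n_theta model u x t"
    by (simp only: constraint_block_def ys)
  then show ?thesis
    using i by (simp add: constraint_def t_def)
qed

text \<open>Components constant along a coordinate line have zero partial derivative; transposing
  turns late coordinates into low rows.\<close>

lemma constraint_jacobian_band:
  assumes "0 < p" and "dim_vec x = n_theta + p * N"
  shows "lower_band (n_theta + p * (n + 1))
    (transpose_mat (constraint_jacobian n p n_theta N model u x))"
  unfolding lower_band_def
  using assms constraint_perturb[of p _ N n x n_theta _ model u]
  by (auto simp: jacobian_def intro!: partial_deriv_eq_0)

theorem proposition1:
  fixes n p n_theta :: nat
  assumes "n > 0" and "p > 0" and "n_theta > 0"
  shows "\<exists>M::real. M > 0 \<and> (\<exists>m\<^sub>0::nat. m\<^sub>0 > 0 \<and>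
    (\<forall>N q model \<rho> u ydata W K \<tau> \<xi>\<^sub>0 k.
       estimation_problem n p q n_theta N model \<rho> u ydata W \<longrightarrow>
       K > 0 \<longrightarrow> \<tau> > 0 \<longrightarrow> \<xi>\<^sub>0 \<in> carrier_vec (n_theta + p * N) \<longrightarrow>
       p * (N - n) > m\<^sub>0 \<longrightarrow>
       real (iteration_flops n p n_theta N model \<rho> u ydata W K \<tau> \<xi>\<^sub>0 k)
         \<le> M * (real (p * (N - n)))\<^sup>2))"
proof -
  define c where "c = n_theta + p * (n + 1)"
  have "real (iteration_flops n p n_theta N model \<rho> u ydata W K \<tau> \<xi>\<^sub>0 k)
      \<le> real (16 * c + 25) * (real (p * (N - n)))\<^sup>2"
    if \<xi>\<^sub>0: "\<xi>\<^sub>0 \<in> carrier_vec (n_theta + p * N)" and m: "p * (N - n) > 1"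
    for N model \<rho> u ydata W K \<tau> \<xi>\<^sub>0 k
  proof -
    define \<xi> where "\<xi> = iterate n p n_theta N model \<rho> u ydata W K \<tau> \<xi>\<^sub>0 k"
    have \<xi>: "dim_vec \<xi> = n_theta + p * N"
      using \<xi>\<^sub>0 by (simp add: \<xi>_def dim_iterate)
    \<comment> \<open>With truncated subtraction, a positive \<open>p * (N - n)\<close> forces this;
      it allows \<open>p * N\<close> to be split into \<open>p * n\<close> and the number of
      constraints.\<close>
    have "n \<le> N"
      using m by (cases "n \<le> N") auto
    then have "p * N = p * n + p * (N - n)"
      by (metis add_mult_distrib2 le_add_diff_inverse)
    then have "n_theta + p * N \<le> c + p * (N - n)"
      by (simp add: c_def)
    then have "iteration_flops n p n_theta N model \<rho> u ydata W K \<tau> \<xi>\<^sub>0 k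
        \<le> (16 * c + 25) * (p * (N - n))\<^sup>2"
      unfolding iteration_flops_def algorithm_step_def \<xi>_def[symmetric]
      using constraint_jacobian_band[OF \<open>p > 0\<close> \<xi>] m \<open>p > 0\<close> \<xi>
      by (intro iteration_step_flops[where \<nu> = "n_theta + p * N"])
        (auto simp add: c_def jacobian_def gradient_def intro: ccontr)
    then show ?thesis
      by (metis of_nat_le_iff of_nat_mult of_nat_power)
  qed
  then show ?thesis
    \<comment> \<open>The witness depends only on \<open>n\<close>, \<open>p\<close> and
      \<open>n_theta\<close> through \<open>c\<close>, as the uniform bound demands.\<close>
    by (intro exI[of _ "real (16 * c + 25)"] exI[of _ 1] conjI) auto
qed

end
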